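(* Suppose that $R$ is a ring, $S\in\mathrm{Den}_l(R,0)$ and $\mathfrak{p}\in\mathrm{Spec}(R)$. 1. Suppose that $S^{-1}\mathfrak{p}\cap R=\mathfrak{p}$. Then $S^{-1}\mathfrak{p}\in\mathrm{Spec}(S^{-1}R)$ if and only if the left ideal $S^{-1}\mathfrak{p}$ of $S^{-1}R$ is an ideal. 2. Suppose that $S^{-1}\mathfrak{p}\cap R\in\mathrm{Spec}(R)$. Then $S^{-1}\mathfrak{p}\in\mathrm{Spec}(S^{-1}R)$ if and only if the left ideal $S^{-1}\mathfrak{p}$ of $S^{-1}R$ is an ideal.
   Context: Rings are associative with $1$; "ideal" means two-sided ideal; $\mathrm{Spec}(R)$ is the set of prime ideals of $R$. A multiplicative subset $S$ of $R$ is a multiplicative subsemigroup with $1\in S$, $0\notin S$. It is a left Ore set if $Sr\cap Rs\neq\emptyset$ for all $r\in R$, $s\in S$. A left Ore set $S$ is a left denominator set if $rs=0$ with $r\in R$, $s\in S$ implies $tr=0$ for some $t\in S$. $\mathrm{Den}_l(R,0)$ is the set of left denominator sets $S$ of $R$ with $\{r\in R\mid sr=0\text{ for some }s\in S\}=0$. $S^{-1}R=\{s^{-1}r\mid s\in S,r\in R\}$ is the left localization; here $R$ is viewed as a subring of $S^{-1}R$ via $r\mapsto\frac{r}{1}$. For a left ideal $I$ of $R$, $S^{-1}I=\{s^{-1}i\mid s\in S,i\in I\}$ is a left ideal of $S^{-1}R$. *)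

theory Defs
  imports "HOL-Algebra.Ideal_Product"
begin

text \<open>Rings are the (not necessarily commutative) unital rings of the locale \<^locale>\<open>ring\<close>, and
  \<^locale>\<open>ideal\<close> is the notion of a two-sided ideal. The library's \<open>primeideal\<close> is restricted to
  commutative rings, so primeness is defined here through products of two-sided ideals.\<close>

definition nc_prime_ideal :: "'a set \<Rightarrow> ('a, 'm) ring_scheme \<Rightarrow> bool" where
  "nc_prime_ideal P R \<longleftrightarrow>
     ideal P R \<and> P \<noteq> carrier R \<and>
     (\<forall>A B. ideal A R \<longrightarrow> ideal B R \<longrightarrow> ideal_prod R A B \<subseteq> P \<longrightarrow> A \<subseteq> P \<or> B \<subseteq> P)"

definition Spec :: "('a, 'm) ring_scheme \<Rightarrow> 'a set set" where
  "Spec R = {P. nc_prime_ideal P R}"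

definition multiplicative_subset :: "('a, 'm) ring_scheme \<Rightarrow> 'a set \<Rightarrow> bool" where
  "multiplicative_subset R S \<longleftrightarrow> submonoid S R \<and> \<zero>\<^bsub>R\<^esub> \<notin> S"

definition left_Ore_set :: "('a, 'm) ring_scheme \<Rightarrow> 'a set \<Rightarrow> bool" where
  "left_Ore_set R S \<longleftrightarrow> multiplicative_subset R S \<and>
     (\<forall>r \<in> carrier R. \<forall>s \<in> S.
        {t \<otimes>\<^bsub>R\<^esub> r | t. t \<in> S} \<inter> {c \<otimes>\<^bsub>R\<^esub> s | c. c \<in> carrier R} \<noteq> {})"

definition left_denominator_set :: "('a, 'm) ring_scheme \<Rightarrow> 'a set \<Rightarrow> bool" where
  "left_denominator_set R S \<longleftrightarrow> left_Ore_set R S \<and>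
     (\<forall>r \<in> carrier R. \<forall>s \<in> S. r \<otimes>\<^bsub>R\<^esub> s = \<zero>\<^bsub>R\<^esub> \<longrightarrow> (\<exists>t \<in> S. t \<otimes>\<^bsub>R\<^esub> r = \<zero>\<^bsub>R\<^esub>))"

definition left_ass :: "('a, 'm) ring_scheme \<Rightarrow> 'a set \<Rightarrow> 'a set" where
  "left_ass R S = {r \<in> carrier R. \<exists>s \<in> S. s \<otimes>\<^bsub>R\<^esub> r = \<zero>\<^bsub>R\<^esub>}"

definition Den_l :: "('a, 'm) ring_scheme \<Rightarrow> 'a set \<Rightarrow> 'a set set" where
  "Den_l R I = {S. left_denominator_set R S \<and> left_ass R S = I}"

text \<open>The pair \<open>(s, r)\<close> stands for \<open>s\<^sup>-\<^sup>1 r\<close>. Two pairs are identified when they have a common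
  expansion \<open>(c s, c r) = (d s', d r')\<close> with \<open>c s \<in> S\<close>; the multipliers \<open>c\<close> and \<open>d\<close> need not
  lie in \<open>S\<close>.\<close>

definition ore_rel :: "('a, 'm) ring_scheme \<Rightarrow> 'a set \<Rightarrow> (('a \<times> 'a) \<times> ('a \<times> 'a)) set" where
  "ore_rel R S = {((s, r), (s', r')).
     s \<in> S \<and> r \<in> carrier R \<and> s' \<in> S \<and> r' \<in> carrier R \<and>
     (\<exists>c \<in> carrier R. \<exists>d \<in> carrier R.
        c \<otimes>\<^bsub>R\<^esub> s \<in> S \<and> c \<otimes>\<^bsub>R\<^esub> s = d \<otimes>\<^bsub>R\<^esub> s' \<and> c \<otimes>\<^bsub>R\<^esub> r = d \<otimes>\<^bsub>R\<^esub> r')}"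

definition left_frac :: "('a, 'm) ring_scheme \<Rightarrow> 'a set \<Rightarrow> 'a \<Rightarrow> 'a \<Rightarrow> ('a \<times> 'a) set" where
  "left_frac R S s r = ore_rel R S `` {(s, r)}"

text \<open>The operations on classes are unions over
  representatives. Addition is \<open>s\<^sup>-\<^sup>1 a + s\<^sup>-\<^sup>1 b = s\<^sup>-\<^sup>1 (a + b)\<close>, over representatives with a common
  denominator. Multiplication is \<open>s\<^sup>-\<^sup>1 a \<cdot> t\<^sup>-\<^sup>1 b = (u s)\<^sup>-\<^sup>1 (c b)\<close> whenever \<open>u a = c t\<close> with
  \<open>u \<in> S\<close>, i.e. \<open>a t\<^sup>-\<^sup>1 = u\<^sup>-\<^sup>1 c\<close>. Independence of all choices is shown below
  (\<open>frac_add\<close>, \<open>frac_mult\<close>).\<close>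

definition left_localization ::
  "('a, 'm) ring_scheme \<Rightarrow> 'a set \<Rightarrow> ('a \<times> 'a) set ring" where
  "left_localization R S =
     \<lparr> carrier = (S \<times> carrier R) // ore_rel R S,
       mult = (\<lambda>X Y. \<Union> {left_frac R S (u \<otimes>\<^bsub>R\<^esub> s) (c \<otimes>\<^bsub>R\<^esub> b) | s a t b u c.
                 (s, a) \<in> X \<and> (t, b) \<in> Y \<and> u \<in> S \<and> c \<in> carrier R \<and>
                 u \<otimes>\<^bsub>R\<^esub> a = c \<otimes>\<^bsub>R\<^esub> t}),
       one = left_frac R S \<one>\<^bsub>R\<^esub> \<one>\<^bsub>R\<^esub>,
       zero = left_frac R S \<one>\<^bsub>R\<^esub> \<zero>\<^bsub>R\<^esub>,
       add = (\<lambda>X Y. \<Union> {left_frac R S s (a \<oplus>\<^bsub>R\<^esub> b) | s a b. (s, a) \<in> X \<and> (s, b) \<in> Y}) \<rparr>"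

definition localize_set :: "('a, 'm) ring_scheme \<Rightarrow> 'a set \<Rightarrow> 'a set \<Rightarrow> ('a \<times> 'a) set set" where
  "localize_set R S I = {left_frac R S s i | s i. s \<in> S \<and> i \<in> I}"

text \<open>\<open>J \<inter> R\<close>, with \<open>R\<close> viewed inside its localization via \<open>r \<mapsto> r/1\<close> (injective by
  \<open>inj_on_frac_one\<close> below), is the set of those \<open>r\<close> with \<open>r/1 \<in> J\<close>.\<close>

definition contract :: "('a, 'm) ring_scheme \<Rightarrow> 'a set \<Rightarrow> ('a \<times> 'a) set set \<Rightarrow> 'a set" where
  "contract R S J = {r \<in> carrier R. left_frac R S \<one>\<^bsub>R\<^esub> r \<in> J}"



locale regular_left_denominator = ring R for R (structure) +
  fixes S
  assumes Den: "S \<in> Den_l R {\<zero>}"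
begin

lemma S_sub: "s \<in> S \<Longrightarrow> s \<in> carrier R"
  and S_mult: "s \<in> S \<Longrightarrow> t \<in> S \<Longrightarrow> s \<otimes> t \<in> S"
  and S_one: "\<one> \<in> S"
  using Den unfolding Den_l_def left_denominator_set_def left_Ore_set_def
    multiplicative_subset_def submonoid_def by auto

lemma ore:
  assumes "r \<in> carrier R" "s \<in> S"
  obtains t c where "t \<in> S" "c \<in> carrier R" "t \<otimes> r = c \<otimes> s"
  using Den assms unfolding Den_l_def left_denominator_set_def left_Ore_set_def by blast

lemma l_regular: "s \<in> S \<Longrightarrow> r \<in> carrier R \<Longrightarrow> s \<otimes> r = \<zero> \<Longrightarrow> r = \<zero>"
  using Den unfolding Den_l_def left_ass_def by blast

lemma r_regular:
  assumes "s \<in> S" "r \<in> carrier R" "r \<otimes> s = \<zero>" shows "r = \<zero>"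
proof -
  from assms Den obtain t where "t \<in> S" "t \<otimes> r = \<zero>"
    unfolding Den_l_def left_denominator_set_def by blast
  then show ?thesis using l_regular assms by blast
qed

lemma lcancel:
  assumes "s \<in> S" "a \<in> carrier R" "b \<in> carrier R" "s \<otimes> a = s \<otimes> b" shows "a = b"
proof -
  have "s \<otimes> (a \<ominus> b) = \<zero>"
    using assms S_sub by (simp add: a_minus_def r_distr r_minus r_neg)
  then have "a \<ominus> b = \<zero>" using l_regular assms by simp
  moreover have "(a \<ominus> b) \<oplus> b = a" using assms by (simp add: a_minus_def a_assoc l_neg)
  ultimately show ?thesis using assms by simp
qed

lemma rcancel:
  assumes "s \<in> S" "a \<in> carrier R" "b \<in> carrier R" "a \<otimes> s = b \<otimes> s" shows "a = b"
proof -
  have "(a \<ominus> b) \<otimes> s = \<zero>"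
    using assms S_sub by (simp add: a_minus_def l_distr l_minus r_neg)
  then have "a \<ominus> b = \<zero>" using r_regular assms by simp
  moreover have "(a \<ominus> b) \<oplus> b = a" using assms by (simp add: a_minus_def a_assoc l_neg)
  ultimately show ?thesis using assms by simp
qed

lemma relD:
  assumes rel: "((s, r), (s', r')) \<in> ore_rel R S"
    and xy: "x \<in> carrier R" "y \<in> carrier R" "x \<otimes> s = y \<otimes> s'"
  shows "x \<otimes> r = y \<otimes> r'"
proof -
  from rel obtain c d where S: "s \<in> S" "r \<in> carrier R" "s' \<in> S" "r' \<in> carrier R"
    and cd: "c \<in> carrier R" "d \<in> carrier R" "c \<otimes> s \<in> S" "c \<otimes> s = d \<otimes> s'" "c \<otimes> r = d \<otimes> r'"
    unfolding ore_rel_def by blast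
  note [simp] = S(2,4) cd(1,2) xy(1,2) S_sub[OF S(1)] S_sub[OF S(3)]
  have "x \<otimes> s \<in> carrier R" by simp
  then obtain w e where w: "w \<in> S" "e \<in> carrier R" "w \<otimes> (x \<otimes> s) = e \<otimes> (c \<otimes> s)"
    using ore cd(3) by blast
  note [simp] = w(2) S_sub[OF w(1)]
  have 1: "w \<otimes> x = e \<otimes> c" by (rule rcancel[OF S(1)]) (use w(3) in \<open>simp_all add: m_assoc\<close>)
  have 2: "w \<otimes> y = e \<otimes> d" by (rule rcancel[OF S(3)]) (use w(3) cd(4) xy(3) in \<open>simp_all add: m_assoc\<close>)
  have "w \<otimes> (x \<otimes> r) = (w \<otimes> x) \<otimes> r" by (simp add: m_assoc)
  also have "\<dots> = e \<otimes> (c \<otimes> r)" by (simp only: 1) (simp add: m_assoc)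
  also have "\<dots> = (e \<otimes> d) \<otimes> r'" by (simp only: cd(5)) (simp add: m_assoc)
  also have "\<dots> = w \<otimes> (y \<otimes> r')" by (simp only: 2[symmetric]) (simp add: m_assoc)
  finally show ?thesis by - (rule lcancel[OF w(1)], simp_all)
qed

lemma relI:
  assumes "s \<in> S" "r \<in> carrier R" "s' \<in> S" "r' \<in> carrier R"
    and "c \<in> carrier R" "d \<in> carrier R" "c \<otimes> s \<in> S" "c \<otimes> s = d \<otimes> s'" "c \<otimes> r = d \<otimes> r'"
  shows "((s, r), (s', r')) \<in> ore_rel R S"
  using assms unfolding ore_rel_def by blast

lemma rel_carr:
  assumes "((s, r), (s', r')) \<in> ore_rel R S"
  shows "s \<in> S" "r \<in> carrier R" "s' \<in> S" "r' \<in> carrier R"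
  using assms unfolding ore_rel_def by blast+

lemma equiv_ore_rel: "equiv (S \<times> carrier R) (ore_rel R S)"
proof (rule equivI)
  show "ore_rel R S \<subseteq> (S \<times> carrier R) \<times> (S \<times> carrier R)"
    unfolding ore_rel_def by auto
  show "refl_on (S \<times> carrier R) (ore_rel R S)"
    by (rule refl_onI) (auto intro!: relI[where c = \<one> and d = \<one>] simp: S_sub)
  show "sym (ore_rel R S)"
    unfolding sym_def ore_rel_def by auto metis
  show "trans (ore_rel R S)"
  proof (rule transI, clarify)
    fix s r s' r' s'' r''
    assume A: "((s, r), (s', r')) \<in> ore_rel R S" and B: "((s', r'), (s'', r'')) \<in> ore_rel R S"
    note cA = rel_carr[OF A] and cB = rel_carr[OF B]
    note [simp] = cA(2,4) cB(4) S_sub[OF cA(1)] S_sub[OF cA(3)] S_sub[OF cB(3)]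
    obtain t c where t: "t \<in> S" "c \<in> carrier R" "t \<otimes> s = c \<otimes> s''"
      using ore[of s s''] cB(3) by auto
    note [simp] = t(2) S_sub[OF t(1)]
    obtain w e where w: "w \<in> S" "e \<in> carrier R" "w \<otimes> (t \<otimes> s) = e \<otimes> s'"
      using ore[of "t \<otimes> s" s'] cA(3) by auto
    note [simp] = w(2) S_sub[OF w(1)]
    have "(w \<otimes> t) \<otimes> r = e \<otimes> r'" by (rule relD[OF A]) (use w(3) in \<open>simp_all add: m_assoc\<close>)
    moreover have "e \<otimes> r' = (w \<otimes> c) \<otimes> r''"
      by (rule relD[OF B]) (use w(3) t(3) in \<open>simp_all add: m_assoc\<close>)
    ultimately have "t \<otimes> r = c \<otimes> r''"
      by - (rule lcancel[OF w(1)], simp_all add: m_assoc)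
    moreover have "t \<otimes> s \<in> S" by (intro S_mult t(1) cA(1))
    ultimately show "((s, r), (s'', r'')) \<in> ore_rel R S"
      using t(3) cA(1) cB(3) by (intro relI[where c = t and d = c]) simp_all
  qed
qed

abbreviation frac :: "'a \<Rightarrow> 'a \<Rightarrow> ('a \<times> 'a) set" where "frac \<equiv> left_frac R S"
abbreviation Q :: "('a \<times> 'a) set ring" where "Q \<equiv> left_localization R S"

lemma mem_frac: "(t, b) \<in> frac s a \<longleftrightarrow> ((s, a), (t, b)) \<in> ore_rel R S"
  by (simp add: left_frac_def)

lemma frac_self: "s \<in> S \<Longrightarrow> a \<in> carrier R \<Longrightarrow> (s, a) \<in> frac s a"
  using equiv_ore_rel by (simp add: mem_frac equiv_def refl_on_def)

lemma frac_eqI: "((s, a), (t, b)) \<in> ore_rel R S \<Longrightarrow> frac s a = frac t b"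
  unfolding left_frac_def by (rule equiv_class_eq[OF equiv_ore_rel])

lemma frac_eq_iff:
  "s \<in> S \<Longrightarrow> a \<in> carrier R \<Longrightarrow> t \<in> S \<Longrightarrow> b \<in> carrier R \<Longrightarrow>
   frac s a = frac t b \<longleftrightarrow> ((s, a), (t, b)) \<in> ore_rel R S"
  unfolding left_frac_def using eq_equiv_class_iff[OF equiv_ore_rel] by simp

lemma carrier_Q: "carrier Q = {frac s r | s r. s \<in> S \<and> r \<in> carrier R}"
  by (auto simp: left_localization_def quotient_def left_frac_def)

lemma frac_carrier: "s \<in> S \<Longrightarrow> r \<in> carrier R \<Longrightarrow> frac s r \<in> carrier Q"
  by (auto simp: carrier_Q)

lemma one_Q: "\<one>\<^bsub>Q\<^esub> = frac \<one> \<one>" and zero_Q: "\<zero>\<^bsub>Q\<^esub> = frac \<one> \<zero>"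
  by (simp_all add: left_localization_def)

lemma frac_expand:
  assumes "s \<in> S" "r \<in> carrier R" "u \<in> carrier R" "u \<otimes> s \<in> S"
  shows "frac (u \<otimes> s) (u \<otimes> r) = frac s r"
  by (rule sym, rule frac_eqI, rule relI[where c = u and d = \<one>])
    (use assms S_sub in simp_all)

lemma frac_add:
  assumes s: "s \<in> S" and ab: "a \<in> carrier R" "b \<in> carrier R"
  shows "frac s a \<oplus>\<^bsub>Q\<^esub> frac s b = frac s (a \<oplus> b)"
proof -
  have "frac t (a' \<oplus> b') = frac s (a \<oplus> b)"
    if A: "(t, a') \<in> frac s a" and B: "(t, b') \<in> frac s b" for t a' b'
  proof -
    note A = A[unfolded mem_frac] and B = B[unfolded mem_frac]
    note cA = rel_carr[OF A] and cB = rel_carr[OF B]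
    note [simp] = ab cA(4) cB(4) S_sub[OF s] S_sub[OF cA(3)]
    obtain u c where u: "u \<in> S" "c \<in> carrier R" "u \<otimes> s = c \<otimes> t"
      using ore[of s t] cA(3) by auto
    note [simp] = u(2) S_sub[OF u(1)]
    have "u \<otimes> a = c \<otimes> a'" "u \<otimes> b = c \<otimes> b'"
      using relD[OF A] relD[OF B] u(3) by simp_all
    then have "u \<otimes> (a \<oplus> b) = c \<otimes> (a' \<oplus> b')" by (simp add: r_distr)
    moreover have "u \<otimes> s \<in> S" by (intro S_mult u(1) s)
    ultimately show ?thesis using s cA(3) u(3)
      by (intro frac_eqI[symmetric] relI[where c = u and d = c]) simp_all
  qed
  then have "{frac t (a' \<oplus> b') | t a' b'. (t, a') \<in> frac s a \<and> (t, b') \<in> frac s b}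
      = {frac s (a \<oplus> b)}"
    using frac_self[OF s ab(1)] frac_self[OF s ab(2)] by blast
  then show ?thesis by (simp add: left_localization_def)
qed

lemma frac_mult:
  assumes s: "s \<in> S" "t \<in> S" and ab: "a \<in> carrier R" "b \<in> carrier R"
    and u: "u \<in> S" "c \<in> carrier R" "u \<otimes> a = c \<otimes> t"
  shows "frac s a \<otimes>\<^bsub>Q\<^esub> frac t b = frac (u \<otimes> s) (c \<otimes> b)"
proof -
  have "frac (u' \<otimes> s') (c' \<otimes> b') = frac (u \<otimes> s) (c \<otimes> b)"
    if A: "(s', a') \<in> frac s a" and B: "(t', b') \<in> frac t b"
      and u': "u' \<in> S" "c' \<in> carrier R" "u' \<otimes> a' = c' \<otimes> t'" for s' a' t' b' u' c'
  proof -
    note A = A[unfolded mem_frac] and B = B[unfolded mem_frac]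
    note cA = rel_carr[OF A] and cB = rel_carr[OF B]
    note [simp] = ab cA(4) cB(4) S_sub[OF s(1)] S_sub[OF s(2)] S_sub[OF cA(3)] S_sub[OF cB(3)]
      u(2) u'(2) S_sub[OF u(1)] S_sub[OF u'(1)]
    obtain w e where w: "w \<in> S" "e \<in> carrier R" "w \<otimes> (u \<otimes> s) = e \<otimes> (u' \<otimes> s')"
      using ore[of "u \<otimes> s" "u' \<otimes> s'"] S_mult u'(1) cA(3) by auto
    note [simp] = w(2) S_sub[OF w(1)]
    have "(w \<otimes> u) \<otimes> a = (e \<otimes> u') \<otimes> a'"
      by (rule relD[OF A]) (use w(3) in \<open>simp_all add: m_assoc\<close>)
    then have "(w \<otimes> c) \<otimes> t = (e \<otimes> c') \<otimes> t'"
      using u(3) u'(3) by (simp add: m_assoc)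
    then have "(w \<otimes> c) \<otimes> b = (e \<otimes> c') \<otimes> b'"
      by - (rule relD[OF B], simp_all)
    then have "w \<otimes> (c \<otimes> b) = e \<otimes> (c' \<otimes> b')" by (simp add: m_assoc)
    moreover have "w \<otimes> (u \<otimes> s) \<in> S" "u \<otimes> s \<in> S" "u' \<otimes> s' \<in> S"
      by (intro S_mult w(1) u(1) s(1) u'(1) cA(3))+
    ultimately show ?thesis using w(3)
      by (intro frac_eqI[symmetric] relI[where c = w and d = e]) simp_all
  qed
  then have "{frac (u' \<otimes> s') (c' \<otimes> b') | s' a' t' b' u' c'.
       (s', a') \<in> frac s a \<and> (t', b') \<in> frac t b \<and> u' \<in> S \<and> c' \<in> carrier R \<and> u' \<otimes> a' = c' \<otimes> t'}
      = {frac (u \<otimes> s) (c \<otimes> b)}"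
    using frac_self[OF s(1) ab(1)] frac_self[OF s(2) ab(2)] u by blast
  then show ?thesis by (simp add: left_localization_def)
qed

lemma common_denominator2:
  assumes "x \<in> carrier Q" "y \<in> carrier Q"
  obtains s a b where "s \<in> S" "a \<in> carrier R" "b \<in> carrier R" "x = frac s a" "y = frac s b"
proof -
  from assms obtain s a t b where st: "s \<in> S" "t \<in> S" "a \<in> carrier R" "b \<in> carrier R"
    and xy: "x = frac s a" "y = frac t b" unfolding carrier_Q by blast
  obtain u c where u: "u \<in> S" "c \<in> carrier R" "u \<otimes> s = c \<otimes> t"
    using ore[of s t] st S_sub by auto
  have us: "u \<otimes> s \<in> S" by (intro S_mult u(1) st(1))
  show thesis
  proof
    show "x = frac (u \<otimes> s) (u \<otimes> a)" using frac_expand[of s a u] st u us S_sub xy by simp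
    show "y = frac (u \<otimes> s) (c \<otimes> b)" using frac_expand[of t b c] st u us S_sub xy by simp
  qed (use st u us S_sub in auto)
qed

lemma common_denominator3:
  assumes "x \<in> carrier Q" "y \<in> carrier Q" "z \<in> carrier Q"
  obtains s a b d where "s \<in> S" "a \<in> carrier R" "b \<in> carrier R" "d \<in> carrier R"
    "x = frac s a" "y = frac s b" "z = frac s d"
proof -
  obtain s a b where 1: "s \<in> S" "a \<in> carrier R" "b \<in> carrier R" "x = frac s a" "y = frac s b"
    using common_denominator2 assms by metis
  from assms obtain t d where 2: "t \<in> S" "d \<in> carrier R" "z = frac t d"
    unfolding carrier_Q by blast
  obtain u c where u: "u \<in> S" "c \<in> carrier R" "u \<otimes> s = c \<otimes> t"
    using ore[of s t] 1 2 S_sub by auto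
  have us: "u \<otimes> s \<in> S" by (intro S_mult u(1) 1(1))
  show thesis
  proof
    show "x = frac (u \<otimes> s) (u \<otimes> a)" using frac_expand[of s a u] 1 u us S_sub by simp
    show "y = frac (u \<otimes> s) (u \<otimes> b)" using frac_expand[of s b u] 1 u us S_sub by simp
    show "z = frac (u \<otimes> s) (c \<otimes> d)" using frac_expand[of t d c] 2 u us S_sub by simp
  qed (use 1 2 u us S_sub in auto)
qed

lemma frac_zero: "s \<in> S \<Longrightarrow> frac s \<zero> = \<zero>\<^bsub>Q\<^esub>"
  using frac_expand[of \<one> \<zero> s] by (simp add: zero_Q S_one S_sub)

lemma abelian_group_Q: "abelian_group Q"
proof (rule abelian_groupI)
  fix x y assume x: "x \<in> carrier Q" and y: "y \<in> carrier Q"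
  obtain s a b where s: "s \<in> S" "a \<in> carrier R" "b \<in> carrier R" "x = frac s a" "y = frac s b"
    using common_denominator2[OF x y] .
  show "x \<oplus>\<^bsub>Q\<^esub> y \<in> carrier Q" using s by (simp add: frac_add frac_carrier)
  show "x \<oplus>\<^bsub>Q\<^esub> y = y \<oplus>\<^bsub>Q\<^esub> x" using s by (simp add: frac_add a_comm)
next
  fix x y z assume "x \<in> carrier Q" "y \<in> carrier Q" "z \<in> carrier Q"
  then obtain s a b d where "s \<in> S" "a \<in> carrier R" "b \<in> carrier R" "d \<in> carrier R"
    "x = frac s a" "y = frac s b" "z = frac s d" by (rule common_denominator3)
  then show "x \<oplus>\<^bsub>Q\<^esub> y \<oplus>\<^bsub>Q\<^esub> z = x \<oplus>\<^bsub>Q\<^esub> (y \<oplus>\<^bsub>Q\<^esub> z)" by (simp add: frac_add a_assoc)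
next
  show "\<zero>\<^bsub>Q\<^esub> \<in> carrier Q" by (simp add: zero_Q frac_carrier S_one)
next
  fix x assume "x \<in> carrier Q"
  then obtain s a where s: "s \<in> S" "a \<in> carrier R" "x = frac s a" unfolding carrier_Q by blast
  show "\<zero>\<^bsub>Q\<^esub> \<oplus>\<^bsub>Q\<^esub> x = x" using s frac_add[of s \<zero> a] by (simp add: frac_zero)
  show "\<exists>y \<in> carrier Q. y \<oplus>\<^bsub>Q\<^esub> x = \<zero>\<^bsub>Q\<^esub>"
    using s by (intro bexI[of _ "frac s (\<ominus> a)"]) (simp_all add: frac_add frac_carrier frac_zero l_neg)
qed

lemma monoid_Q: "monoid Q"
proof (rule monoidI)
  fix x y assume "x \<in> carrier Q" "y \<in> carrier Q"
  then obtain s a t b where s: "s \<in> S" "a \<in> carrier R" "x = frac s a"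
    and t: "t \<in> S" "b \<in> carrier R" "y = frac t b" unfolding carrier_Q by blast
  obtain u c where "u \<in> S" "c \<in> carrier R" "u \<otimes> a = c \<otimes> t" using ore[OF s(2) t(1)] .
  then show "x \<otimes>\<^bsub>Q\<^esub> y \<in> carrier Q" using s t by (simp add: frac_mult frac_carrier S_mult)
next
  show "\<one>\<^bsub>Q\<^esub> \<in> carrier Q" by (simp add: one_Q frac_carrier S_one)
next
  fix x y z assume "x \<in> carrier Q" "y \<in> carrier Q" "z \<in> carrier Q"
  then obtain s a t b v d where s: "s \<in> S" "a \<in> carrier R" "x = frac s a"
    and t: "t \<in> S" "b \<in> carrier R" "y = frac t b"
    and v: "v \<in> S" "d \<in> carrier R" "z = frac v d" unfolding carrier_Q by blast
  obtain w e where w: "w \<in> S" "e \<in> carrier R" "w \<otimes> b = e \<otimes> v" using ore[OF t(2) v(1)] .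
  have wt: "w \<otimes> t \<in> S" by (intro S_mult w(1) t(1))
  obtain u c where u: "u \<in> S" "c \<in> carrier R" "u \<otimes> a = c \<otimes> (w \<otimes> t)" using ore[OF s(2) wt] .
  note [simp] = s(2) t(2) v(2) w(2) u(2) S_sub[OF s(1)] S_sub[OF t(1)] S_sub[OF v(1)]
    S_sub[OF w(1)] S_sub[OF u(1)]
  have us: "u \<otimes> s \<in> S" by (intro S_mult u(1) s(1))
  have "y \<otimes>\<^bsub>Q\<^esub> z = frac (w \<otimes> t) (e \<otimes> d)"
    unfolding t v by (rule frac_mult) (use t v w in simp_all)
  then have R: "x \<otimes>\<^bsub>Q\<^esub> (y \<otimes>\<^bsub>Q\<^esub> z) = frac (u \<otimes> s) (c \<otimes> (e \<otimes> d))"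
    unfolding s by (simp, intro frac_mult) (use s wt u in simp_all)
  have "x \<otimes>\<^bsub>Q\<^esub> y = frac (u \<otimes> s) ((c \<otimes> w) \<otimes> b)"
    unfolding s t by (rule frac_mult) (use s t u in \<open>simp_all add: m_assoc\<close>)
  then have "(x \<otimes>\<^bsub>Q\<^esub> y) \<otimes>\<^bsub>Q\<^esub> z = frac (\<one> \<otimes> (u \<otimes> s)) ((c \<otimes> e) \<otimes> d)"
    unfolding v by (simp only:, intro frac_mult) (use us v w S_one in \<open>simp_all add: m_assoc\<close>)
  then show "(x \<otimes>\<^bsub>Q\<^esub> y) \<otimes>\<^bsub>Q\<^esub> z = x \<otimes>\<^bsub>Q\<^esub> (y \<otimes>\<^bsub>Q\<^esub> z)" using R by (simp add: m_assoc)
next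
  fix x assume "x \<in> carrier Q"
  then obtain s a where s: "s \<in> S" "a \<in> carrier R" "x = frac s a" unfolding carrier_Q by blast
  show "\<one>\<^bsub>Q\<^esub> \<otimes>\<^bsub>Q\<^esub> x = x"
    using frac_mult[of \<one> s \<one> a s \<one>] s S_one S_sub by (simp add: one_Q)
  show "x \<otimes>\<^bsub>Q\<^esub> \<one>\<^bsub>Q\<^esub> = x"
    using frac_mult[of s \<one> a \<one> \<one> a] s S_one S_sub by (simp add: one_Q)
qed

theorem ring_Q: "ring Q"
proof (rule ringI[OF abelian_group_Q monoid_Q])
  fix x y z assume x: "x \<in> carrier Q" and y: "y \<in> carrier Q" and z: "z \<in> carrier Q"
  obtain s a b where s: "s \<in> S" "a \<in> carrier R" "b \<in> carrier R" "x = frac s a" "y = frac s b"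
    using common_denominator2[OF x y] .
  obtain v d where v: "v \<in> S" "d \<in> carrier R" "z = frac v d" using z unfolding carrier_Q by blast
  obtain u c where u: "u \<in> S" "c \<in> carrier R" "u \<otimes> a = c \<otimes> v" using ore[OF s(2) v(1)] .
  note [simp] = s(2,3) v(2) u(2) S_sub[OF s(1)] S_sub[OF v(1)] S_sub[OF u(1)]
  obtain w e where w: "w \<in> S" "e \<in> carrier R" "w \<otimes> (u \<otimes> b) = e \<otimes> v"
    using ore[of "u \<otimes> b" v] v(1) by auto
  note [simp] = w(2) S_sub[OF w(1)]
  have wu: "w \<otimes> u \<in> S" by (intro S_mult w(1) u(1))
  then have wus: "(w \<otimes> u) \<otimes> s \<in> S" using s S_mult by simp
  have a: "(w \<otimes> u) \<otimes> a = (w \<otimes> c) \<otimes> v" using u(3) by (simp add: m_assoc)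
  have b: "(w \<otimes> u) \<otimes> b = e \<otimes> v" using w(3) by (simp add: m_assoc)
  have ab: "(w \<otimes> u) \<otimes> (a \<oplus> b) = (w \<otimes> c \<oplus> e) \<otimes> v" using a b by (simp add: r_distr l_distr)
  show "(x \<oplus>\<^bsub>Q\<^esub> y) \<otimes>\<^bsub>Q\<^esub> z = x \<otimes>\<^bsub>Q\<^esub> z \<oplus>\<^bsub>Q\<^esub> y \<otimes>\<^bsub>Q\<^esub> z"
    using frac_mult[OF s(1) v(1) s(2) v(2) wu _ a] frac_mult[OF s(1) v(1) s(3) v(2) wu _ b]
      frac_mult[OF s(1) v(1) _ v(2) wu _ ab] s(1) wus
    unfolding s v by (simp add: frac_add l_distr)
next
  fix x y z assume x: "x \<in> carrier Q" and y: "y \<in> carrier Q" and z: "z \<in> carrier Q"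
  obtain t a b where t: "t \<in> S" "a \<in> carrier R" "b \<in> carrier R" "x = frac t a" "y = frac t b"
    using common_denominator2[OF x y] .
  obtain s d where s: "s \<in> S" "d \<in> carrier R" "z = frac s d" using z unfolding carrier_Q by blast
  obtain u c where u: "u \<in> S" "c \<in> carrier R" "u \<otimes> d = c \<otimes> t" using ore[OF s(2) t(1)] .
  have us: "u \<otimes> s \<in> S" by (intro S_mult u(1) s(1))
  show "z \<otimes>\<^bsub>Q\<^esub> (x \<oplus>\<^bsub>Q\<^esub> y) = z \<otimes>\<^bsub>Q\<^esub> x \<oplus>\<^bsub>Q\<^esub> z \<otimes>\<^bsub>Q\<^esub> y"
    using frac_mult[OF s(1) t(1) s(2) _ u] us t s u
    unfolding s t by (simp add: frac_add r_distr)
qed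

lemma frac_one_hom: "frac \<one> \<in> ring_hom R Q"
proof (rule ring_hom_memI)
  fix a b assume ab: "a \<in> carrier R" "b \<in> carrier R"
  show "frac \<one> (a \<otimes> b) = frac \<one> a \<otimes>\<^bsub>Q\<^esub> frac \<one> b"
    using frac_mult[of \<one> \<one> a b \<one> a] ab S_one by simp
  show "frac \<one> (a \<oplus> b) = frac \<one> a \<oplus>\<^bsub>Q\<^esub> frac \<one> b"
    using ab S_one by (simp add: frac_add)
qed (simp_all add: frac_carrier S_one one_Q)

lemma inj_on_frac_one: "inj_on (frac \<one>) (carrier R)"
proof (rule inj_onI)
  fix a b assume ab: "a \<in> carrier R" "b \<in> carrier R" "frac \<one> a = frac \<one> b"
  then have "((\<one>, a), (\<one>, b)) \<in> ore_rel R S" using frac_eq_iff S_one by simp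
  from relD[OF this, of \<one> \<one>] show "a = b" using ab by simp
qed

lemma frac_one_inverse:
  assumes "s \<in> S"
  shows "frac s \<one> \<otimes>\<^bsub>Q\<^esub> frac \<one> s = \<one>\<^bsub>Q\<^esub>" "frac \<one> s \<otimes>\<^bsub>Q\<^esub> frac s \<one> = \<one>\<^bsub>Q\<^esub>"
  using frac_mult[of s \<one> \<one> s \<one> \<one>] frac_mult[of \<one> s s \<one> \<one> \<one>] frac_expand[of \<one> \<one> s]
    assms S_one S_sub by (simp_all add: one_Q)

lemma frac_eq_inv_mult:
  assumes "s \<in> S" "r \<in> carrier R"
  shows "frac s r = inv\<^bsub>Q\<^esub> (frac \<one> s) \<otimes>\<^bsub>Q\<^esub> frac \<one> r"
proof -
  interpret Q: monoid Q by (rule monoid_Q)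
  have "inv\<^bsub>Q\<^esub> (frac \<one> s) = frac s \<one>"
    by (rule sym, rule Q.inv_unique') (use assms S_one S_sub in \<open>simp_all add: frac_carrier frac_one_inverse\<close>)
  then show ?thesis using frac_mult[of s \<one> \<one> r \<one> \<one>] assms S_one S_sub by simp
qed

end

end

theory Submission
  imports Defs "HOL-Algebra.QuotRing"
begin

text \<open>A proper ideal \<open>J\<close> of \<open>S\<^sup>-\<^sup>1R\<close> is prime as soon as \<open>J \<inter> R\<close> is: if \<open>A B \<subseteq> J\<close>, then
  \<open>(A \<inter> R) (B \<inter> R) \<subseteq> J \<inter> R\<close>, so that, say, \<open>A \<inter> R \<subseteq> J \<inter> R\<close>; since every ideal of
  \<open>S\<^sup>-\<^sup>1R\<close> is generated by its contraction, \<open>A \<subseteq> J\<close>. Both parts are instances of this.\<close>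

context regular_left_denominator
begin

lemma ring_hom_ring_frac_one: "ring_hom_ring R Q (frac \<one>)"
  by (intro ring_hom_ringI2 ring_axioms ring_Q frac_one_hom)

lemma ideal_contract: "ideal J Q \<Longrightarrow> ideal (contract R S J) R"
  unfolding contract_def by (rule ring_hom_ring.ideal_vimage[OF ring_hom_ring_frac_one])

text \<open>The elements \<open>frac s a\<close> and \<open>frac \<one> a\<close> differ by a unit:
  left multiplication by \<open>frac \<one> s\<close> and by its inverse
  \<open>frac s \<one>\<close> turns each into the other, so an ideal contains both or
  neither.\<close>

lemma frac_mem_ideal_iff:
  assumes "ideal J Q" "s \<in> S" "a \<in> carrier R"
  shows "frac s a \<in> J \<longleftrightarrow> a \<in> contract R S J"
proof -
  interpret J: ideal J Q by fact
  note S_sub[OF assms(2), simp]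
  have "frac \<one> a = frac \<one> s \<otimes>\<^bsub>Q\<^esub> frac s a"
    using frac_mult[of \<one> s s a \<one> \<one>] assms S_one by simp
  moreover have "frac s a = frac s \<one> \<otimes>\<^bsub>Q\<^esub> frac \<one> a"
    using frac_mult[of s \<one> \<one> a \<one> \<one>] assms S_one by simp
  ultimately show ?thesis
    using assms J.I_l_closed[of "frac s a" "frac \<one> s"] J.I_l_closed[of "frac \<one> a" "frac s \<one>"]
    by (auto simp: contract_def frac_carrier S_one)
qed

lemma contract_subset_contractD:
  assumes "ideal A Q" "ideal J Q" "contract R S A \<subseteq> contract R S J"
  shows "A \<subseteq> J"
proof
  fix x assume "x \<in> A"
  moreover from this obtain s a where "s \<in> S" "a \<in> carrier R" "x = frac s a"
    using ideal.Icarr[OF assms(1)] unfolding carrier_Q by blast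
  ultimately show "x \<in> J" using assms frac_mem_ideal_iff by blast
qed

text \<open>Since r \<mapsto> r/1 preserves products and sums, induction on the generation of
  \<open>ideal_prod\<close> by products and sums carries each element over.\<close>

lemma ideal_prod_contract_subset:
  assumes "ideal A Q" "ideal B Q"
  shows "ideal_prod R (contract R S A) (contract R S B) \<subseteq> contract R S (ideal_prod Q A B)"
proof -
  interpret h: ring_hom_ring R Q "frac \<one>" by (rule ring_hom_ring_frac_one)
  have "r \<in> contract R S (ideal_prod Q A B)"
    if "r \<in> ideal_prod R (contract R S A) (contract R S B)" for r
    using that
    by (induction rule: ideal_prod.induct) (auto simp: contract_def intro: ideal_prod.intros)
  then show ?thesis by blast
qed

lemma nc_prime_ideal_if_contract:
  assumes J: "ideal J Q" and prime: "nc_prime_ideal (contract R S J) R"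
  shows "nc_prime_ideal J Q"
  unfolding nc_prime_ideal_def
proof (intro conjI allI impI)
  \<comment> \<open>If \<open>J\<close> were all of \<open>Q\<close>, every r/1 would lie in
    \<open>J\<close>, so the contraction would be all of \<open>R\<close>.\<close>
  show "J \<noteq> carrier Q"
    using prime by (auto simp: nc_prime_ideal_def contract_def frac_carrier S_one)
next
  fix A B assume AB: "ideal A Q" "ideal B Q" "ideal_prod Q A B \<subseteq> J"
  have "ideal_prod R (contract R S A) (contract R S B) \<subseteq> contract R S J"
    using ideal_prod_contract_subset[OF AB(1,2)] AB(3) by (auto simp: contract_def)
  then have "contract R S A \<subseteq> contract R S J \<or> contract R S B \<subseteq> contract R S J"
    using prime AB(1,2) ideal_contract unfolding nc_prime_ideal_def by blast
  then show "A \<subseteq> J \<or> B \<subseteq> J"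
    using contract_subset_contractD J AB(1,2) by blast
qed (rule J)

end

theorem corollary2p7:
  fixes R :: "('a, 'm) ring_scheme" and S p :: "'a set"
  assumes "ring R"
    and "S \<in> Den_l R {\<zero>\<^bsub>R\<^esub>}"
    and "p \<in> Spec R"
  shows "(contract R S (localize_set R S p) = p \<longrightarrow>
           (localize_set R S p \<in> Spec (left_localization R S) \<longleftrightarrow>
            ideal (localize_set R S p) (left_localization R S))) \<and>
         (contract R S (localize_set R S p) \<in> Spec R \<longrightarrow>
           (localize_set R S p \<in> Spec (left_localization R S) \<longleftrightarrow>
            ideal (localize_set R S p) (left_localization R S)))"
proof -
  interpret regular_left_denominator R S
    using assms(1,2) by (simp add: regular_left_denominator_def regular_left_denominator_axioms_def)
  \<comment> \<open>This is the second claim, where only the passage from ideal to prime has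
    content. In the first claim the contraction equals \<open>p\<close>, which is prime by
    assumption.\<close>
  have "localize_set R S p \<in> Spec Q \<longleftrightarrow> ideal (localize_set R S p) Q"
    if "contract R S (localize_set R S p) \<in> Spec R"
    using that nc_prime_ideal_if_contract by (auto simp: Spec_def nc_prime_ideal_def[of _ Q])
  with assms(3) show ?thesis by auto
qed

end
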